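(* Let $0<p<1$ be a constant. For $N\ge 1$ let $G(N,p)$ be the random graph on vertex set $\{0,1,\dots,N-1\}$ in which each pair of distinct vertices is joined by an edge independently with probability $p$. Then the probability that the cops have a winning strategy in the cops and robber game played on $G(N,p)$ by one pair of tandem-cops against one robber tends to $1$ as $N\to\infty$.
   Context: Cops and robber game on a finite simple graph $G$: graphs are treated as reflexive, i.e. a player may stay at its current vertex as a move. Players occupy vertices, the game is played with perfect information in a countable sequence of rounds with the cops and the robber moving alternately; the robber in his turn moves along an edge to an adjacent vertex or stays put. The cops win if after some finite number of rounds at least one cop occupies the same vertex as the robber; the robber wins if he avoids the cops forever. Tandem-cops: two cops $C_1,C_2$ that move in tandem, i.e. at all times they are at the same vertex or at adjacent vertices. In the cops' turn, $C_1$ moves from its position to a vertex $x_1'$ adjacent to (or equal to) its current position, and then $C_2$ moves to $x_1'$ or to any vertex adjacent to $x_1'$. *)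

theory Defs
  imports "HOL-Probability.Probability" "HOL-Probability.Product_PMF"
begin

text \<open>A simple graph is given by a vertex set \<open>V\<close> and a set \<open>E\<close> of two-element subsets of \<open>V\<close>.\<close>

definition all_edges :: "'a set \<Rightarrow> 'a set set" where
  "all_edges V = {e. e \<subseteq> V \<and> card e = 2}"

definition random_graph :: "nat \<Rightarrow> real \<Rightarrow> nat set set pmf" where
  "random_graph N p =
     map_pmf (\<lambda>X. {e \<in> all_edges {0..<N}. X e})
       (Pi_pmf (all_edges {0..<N}) False (\<lambda>_. bernoulli_pmf p))"

text \<open>Graphs are reflexive for the purposes of the game: a player may stay put.\<close>

definition step :: "'a set \<Rightarrow> 'a set set \<Rightarrow> 'a \<Rightarrow> 'a \<Rightarrow> bool" where
  "step V E u v \<longleftrightarrow> u \<in> V \<and> v \<in> V \<and> (u = v \<or> {u, v} \<in> E)"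

text \<open>
  A play consists of the positions \<open>c n = (c\<^sub>1, c\<^sub>2)\<close> of the two cops and \<open>r n\<close> of the
  robber. The cops choose \<open>c 0\<close>, then the robber chooses \<open>r 0\<close>; in each further round the cops
  move from \<open>c n\<close> to \<open>c (Suc n)\<close> and then the robber moves from \<open>r n\<close> to \<open>r (Suc n)\<close>.
  The second cop's new position is constrained only by the first cop's new position,
  not by the second cop's own previous position.
\<close>

definition tandem_play :: "'a set \<Rightarrow> 'a set set \<Rightarrow> (nat \<Rightarrow> 'a \<times> 'a) \<Rightarrow> bool" where
  "tandem_play V E c \<longleftrightarrow>
     step V E (fst (c 0)) (snd (c 0)) \<and>
     (\<forall>n. step V E (fst (c n)) (fst (c (Suc n))) \<and>
          step V E (fst (c (Suc n))) (snd (c (Suc n))))"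

definition robber_play :: "'a set \<Rightarrow> 'a set set \<Rightarrow> (nat \<Rightarrow> 'a) \<Rightarrow> bool" where
  "robber_play V E r \<longleftrightarrow> r 0 \<in> V \<and> (\<forall>n. step V E (r n) (r (Suc n)))"

text \<open>The robber may be caught after his own placement or move, or after a move of the cops.\<close>

definition captured :: "(nat \<Rightarrow> 'a \<times> 'a) \<Rightarrow> (nat \<Rightarrow> 'a) \<Rightarrow> bool" where
  "captured c r \<longleftrightarrow>
     (\<exists>n. r n \<in> {fst (c n), snd (c n)} \<or> r n \<in> {fst (c (Suc n)), snd (c (Suc n))})"

text \<open>A strategy maps the whole history of the play to the next position of the cops; the
  empty history gives the initial placement.\<close>

type_synonym 'a strategy = "(('a \<times> 'a) \<times> 'a) list \<Rightarrow> 'a \<times> 'a"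

definition follows :: "'a strategy \<Rightarrow> (nat \<Rightarrow> 'a \<times> 'a) \<Rightarrow> (nat \<Rightarrow> 'a) \<Rightarrow> bool" where
  "follows \<sigma> c r \<longleftrightarrow> (\<forall>n. c n = \<sigma> (map (\<lambda>i. (c i, r i)) [0..<n]))"

text \<open>For every \<open>\<sigma>\<close> and \<open>r\<close> there is exactly one \<open>c\<close> with \<open>follows \<sigma> c r\<close>. Legality is also
  required after a capture, which costs nothing because the cops may stay put.\<close>

definition winning_strategy :: "'a set \<Rightarrow> 'a set set \<Rightarrow> 'a strategy \<Rightarrow> bool" where
  "winning_strategy V E \<sigma> \<longleftrightarrow>
     (\<forall>c r. robber_play V E r \<and> follows \<sigma> c r \<longrightarrow> tandem_play V E c \<and> captured c r)"

definition tandem_win :: "'a set \<Rightarrow> 'a set set \<Rightarrow> bool" where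
  "tandem_win V E \<longleftrightarrow> (\<exists>\<sigma>. winning_strategy V E \<sigma>)"

end

theory Submission imports Defs "HOL-Real_Asymp.Real_Asymp" begin

text \<open>
  The second cop may jump to any neighbour of the first cop, so the tandem catches a robber at
  distance at most two in a single move. Hence the cops win by starting at vertex \<open>0\<close> as soon as
  every vertex is within distance two of \<open>0\<close>. For a fixed vertex \<open>v\<close>, the \<open>N - 2\<close> possible paths
  from \<open>0\<close> to \<open>v\<close> of length two are edge-disjoint, so they are all absent with probability
  \<open>(1 - p\<^sup>2) ^ (N - 2)\<close>, and a union bound over \<open>v\<close> finishes the proof.
\<close>

lemma tandem_win_if_radius_two:
  assumes u: "u \<in> V"
    and two: "\<And>v. v \<in> V \<Longrightarrow> \<exists>w. step V E u w \<and> step V E w v"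
  shows "tandem_win V E"
proof -
  obtain m where m: "\<And>v. v \<in> V \<Longrightarrow> step V E u (m v) \<and> step V E (m v) v"
    using two by metis
  define \<sigma> :: "'a strategy" where
    \<comment> \<open>Only the head of the history, the initial placement, is read. The first cop
      goes to a midpoint, the second lands on the robber's starting vertex, and both then stay put,
      so the play remains legal after the capture.\<close>
    "\<sigma> h = (case h of [] \<Rightarrow> (u, u) | x # _ \<Rightarrow> (m (snd x), snd x))" for h
  have "tandem_play V E c \<and> captured c r" if r: "robber_play V E r" and f: "follows \<sigma> c r" for c r
  proof -
    have c: "c n = \<sigma> (map (\<lambda>i. (c i, r i)) [0..<n])" for n
      using f unfolding follows_def by blast
    have c0: "c 0 = (u, u)"
      by (subst c) (simp add: \<sigma>_def)
    have cS: "c (Suc n) = (m (r 0), r 0)" for n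
    proof -
      have "map (\<lambda>i. (c i, r i)) [0..<Suc n] = (c 0, r 0) # map (\<lambda>i. (c i, r i)) [1..<Suc n]"
        by (subst upt_conv_Cons) auto
      then show ?thesis
        by (subst c) (simp add: \<sigma>_def del: upt_Suc)
    qed
    have r0: "r 0 \<in> V"
      using r by (simp add: robber_play_def)
    have "step V E (fst (c n)) (fst (c (Suc n)))" for n
      using m[OF r0] c0 cS by (cases n) (auto simp: step_def)
    then have "tandem_play V E c"
      using m[OF r0] c0 cS u by (auto simp: tandem_play_def step_def)
    moreover have "captured c r"
      \<comment> \<open>In round 0 the second alternative of \<open>captured\<close> applies: the
        cops answer the placement \<open>r 0\<close> before the robber moves.\<close>
      unfolding captured_def by (rule exI[of _ 0]) (simp add: cS)
    ultimately show ?thesis ..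
  qed
  then show ?thesis
    unfolding tandem_win_def winning_strategy_def by blast
qed

lemma prob_Pi_bernoulli_all_True:
  assumes "finite A" "K \<subseteq> A" "0 \<le> p" "p \<le> 1"
  shows "measure_pmf.prob (Pi_pmf A d (\<lambda>_. bernoulli_pmf p)) {X. \<forall>e\<in>K. X e} = p ^ card K"
proof -
  \<comment> \<open>As a product set, with unconstrained factors off \<open>K\<close>, the event has
    a probability that factorises over \<open>A\<close>.\<close>
  have "{X. \<forall>e\<in>K. X e} = Pi A (\<lambda>e. if e \<in> K then {True} else UNIV)"
    using assms(2) by (auto simp: Pi_def split: if_splits)
  then have "measure_pmf.prob (Pi_pmf A d (\<lambda>_. bernoulli_pmf p)) {X. \<forall>e\<in>K. X e} =
      (\<Prod>e\<in>A. if e \<in> K then p else 1)"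
    using assms by (simp add: measure_Pi_pmf_Pi measure_pmf_single if_distrib cong: if_cong)
  also have "\<dots> = p ^ card K"
    using assms by (simp add: prod.If_cases Int_absorb1)
  finally show ?thesis .
qed

text \<open>Restrictions of \<open>X\<close> to disjoint blocks are independent, so the
  probabilities that the single blocks are incomplete multiply.\<close>

lemma prob_Pi_bernoulli_disjoint_blocks:
  assumes A: "finite A" and W: "finite W" and p: "0 \<le> p" "p \<le> 1"
    and K: "\<And>w. w \<in> W \<Longrightarrow> K w \<subseteq> A" and disj: "disjoint_family_on K W"
  shows "measure_pmf.prob (Pi_pmf A d (\<lambda>_. bernoulli_pmf p)) {X. \<forall>w\<in>W. \<exists>e\<in>K w. \<not> X e} =
    (\<Prod>w\<in>W. 1 - p ^ card (K w))"
\<comment> \<open>The product rule for independent variables needs a nonempty index set; for empty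
  \<open>W\<close> both sides are 1.\<close>
proof (cases "W = {}")
  case False
  let ?M = "measure_pmf (Pi_pmf A d (\<lambda>_. bernoulli_pmf p))"
  let ?Y = "\<lambda>w X. restrict X (K w)"
  define B where "B w = {f \<in> K w \<rightarrow>\<^sub>E (UNIV :: bool set). \<exists>e\<in>K w. \<not> f e}" for w
  have ind: "prob_space.indep_vars ?M (\<lambda>w. PiM (K w) (\<lambda>_. count_space UNIV)) ?Y W"
    by (rule prob_space.indep_vars_restrict[OF measure_pmf.prob_space_axioms indep_vars_Pi_pmf[OF A] K disj])
  have finK: "finite (K w)" if "w \<in> W" for w
    using K[OF that] A finite_subset by blast
  \<comment> \<open>Blocks are finite, so the product of the discrete spaces is itself discrete and
    every set of functions on a block is measurable.\<close>
  have B: "B w \<in> sets (PiM (K w) (\<lambda>_. count_space UNIV))" if "w \<in> W" for w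
    using finK[OF that] by (subst count_space_PiM_finite) (auto simp: B_def)
  have vim: "(\<lambda>X. restrict X (K w)) -` B w = {X. \<exists>e\<in>K w. \<not> X e}" for w
    by (auto simp: B_def)
  have pr: "measure ?M {X. \<exists>e\<in>K w. \<not> X e} = 1 - p ^ card (K w)" if "w \<in> W" for w
  proof -
    have "measure ?M (space ?M - {X. \<forall>e\<in>K w. X e}) = 1 - p ^ card (K w)"
      using prob_Pi_bernoulli_all_True[OF A K[OF that] p] by (subst measure_pmf.prob_compl) auto
    moreover have "space ?M - {X. \<forall>e\<in>K w. X e} = {X. \<exists>e\<in>K w. \<not> X e}"
      by auto
    ultimately show ?thesis by simp
  qed
  have "{X. \<forall>w\<in>W. \<exists>e\<in>K w. \<not> X e} = (\<Inter>w\<in>W. {X. \<exists>e\<in>K w. \<not> X e})"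
    by auto
  then show ?thesis
    using prob_space.indep_varsD_finite[OF measure_pmf.prob_space_axioms ind False W B] by (simp add: vim pr)
qed simp

lemma finite_all_edges: "finite V \<Longrightarrow> finite (all_edges V)"
  unfolding all_edges_def by (rule finite_subset[of _ "Pow V"]) auto

lemma prob_no_common_neighbour:
  fixes p :: real
  assumes p: "0 < p" "p < 1" and v: "v \<in> {1..<N}"
  shows "measure_pmf.prob (random_graph N p)
      {E. \<forall>w\<in>{1..<N} - {v}. \<not> ({0, w} \<in> E \<and> {w, v} \<in> E)} = (1 - p\<^sup>2) ^ (N - 2)"
proof -
  let ?A = "all_edges {0..<N}" and ?W = "{1..<N} - {v}"
  define K :: "nat \<Rightarrow> nat set set" where "K w = {{0, w}, {w, v}}" for w
  have K: "K w \<subseteq> ?A" if "w \<in> ?W" for w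
    using that v by (auto simp: K_def all_edges_def)
  \<comment> \<open>Since \<open>v\<close> and the midpoints are nonzero, \<open>{0, w}\<close>
    never equals \<open>{w', v}\<close>, so each edge determines its midpoint. For the same reason
    the two edges of a path are distinct.\<close>
  have disj: "disjoint_family_on K ?W"
    using v by (auto simp: K_def disjoint_family_on_def doubleton_eq_iff)
  have cardK: "card (K w) = 2" if "w \<in> ?W" for w
    using that v by (auto simp: K_def card_insert_if doubleton_eq_iff)
  have "(\<lambda>X. {e \<in> ?A. X e}) -` {E. \<forall>w\<in>?W. \<not> ({0, w} \<in> E \<and> {w, v} \<in> E)}
      = {X. \<forall>w\<in>?W. \<exists>e\<in>K w. \<not> X e}"
    using K by (fastforce simp: K_def)
  then have "measure_pmf.prob (random_graph N p)
      {E. \<forall>w\<in>?W. \<not> ({0, w} \<in> E \<and> {w, v} \<in> E)} = (\<Prod>w\<in>?W. 1 - p ^ card (K w))"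
    using p by (simp only: random_graph_def measure_map_pmf)
      (intro prob_Pi_bernoulli_disjoint_blocks finite_all_edges K disj; simp)
  also have "\<dots> = (1 - p\<^sup>2) ^ (N - 2)"
    using v by (simp add: cardK numeral_2_eq_2)
  finally show ?thesis .
qed

lemma prob_tandem_win_ge:
  fixes p :: real
  assumes p: "0 < p" "p < 1" and N: "N \<ge> 1"
  shows "measure_pmf.prob (random_graph N p) {E. tandem_win {0..<N} E}
    \<ge> 1 - real N * (1 - p\<^sup>2) ^ (N - 2)"
proof -
  let ?P = "measure_pmf.prob (random_graph N p)" and ?V = "{0..<N}"
  let ?F = "\<lambda>v. {E. \<forall>w\<in>{1..<N} - {v}. \<not> ({0, w} \<in> E \<and> {w, v} \<in> E)}"
  have q: "0 \<le> 1 - p\<^sup>2"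
    using p by (simp add: power_le_one)
  have "- {E. tandem_win ?V E} \<subseteq> (\<Union>v\<in>{1..<N}. ?F v)"
  proof
    fix E assume E: "E \<in> - {E. tandem_win ?V E}"
    show "E \<in> (\<Union>v\<in>{1..<N}. ?F v)"
    proof (rule ccontr)
      assume no: "E \<notin> (\<Union>v\<in>{1..<N}. ?F v)"
      have "\<exists>w. step ?V E 0 w \<and> step ?V E w v" if "v \<in> ?V" for v
      \<comment> \<open>Vertex 0 reaches itself by staying put, so only targets \<open>v\<close>
        \<ge> 1 can fail.\<close>
      proof (cases "v = 0")
        case True
        then show ?thesis using N by (intro exI[of _ 0]) (simp add: step_def)
      next
        case False
        with that have "v \<in> {1..<N}" by simp
        with no have "E \<notin> ?F v" by (meson UN_I)
        then obtain w where "w \<in> {1..<N} - {v}" "{0, w} \<in> E" "{w, v} \<in> E"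
          by blast
        then show ?thesis using that by (intro exI[of _ w]) (auto simp: step_def)
      qed
      then have "tandem_win ?V E"
        using N by (intro tandem_win_if_radius_two[of 0]) auto
      with E show False by simp
    qed
  qed
  then have "?P (- {E. tandem_win ?V E}) \<le> ?P (\<Union>v\<in>{1..<N}. ?F v)"
    by (intro measure_pmf.finite_measure_mono) auto
  also have "\<dots> \<le> (\<Sum>v\<in>{1..<N}. ?P (?F v))"
    by (intro measure_pmf.finite_measure_subadditive_finite) auto
  also have "\<dots> = (\<Sum>v\<in>{1..<N}. (1 - p\<^sup>2) ^ (N - 2))"
    by (intro sum.cong refl prob_no_common_neighbour p)
  also have "\<dots> \<le> real N * (1 - p\<^sup>2) ^ (N - 2)"
    using q by (simp add: mult_right_mono)
  finally show ?thesis
    using measure_pmf.prob_compl[of "{E. tandem_win ?V E}" "random_graph N p"]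
    by (simp add: Compl_eq_Diff_UNIV)
qed

theorem theorem6:
  fixes p :: real
  assumes "0 < p" and "p < 1"
  shows "(\<lambda>N. measure_pmf.prob (random_graph N p) {E. tandem_win {0..<N} E}) \<longlonglongrightarrow> 1"
proof (rule tendsto_sandwich)
  let ?P = "\<lambda>N. measure_pmf.prob (random_graph N p) {E. tandem_win {0..<N} E}"
  show "\<forall>\<^sub>F N in sequentially. 1 - real N * (1 - p\<^sup>2) ^ (N - 2) \<le> ?P N"
    using eventually_ge_at_top[of 1] by eventually_elim (rule prob_tandem_win_ge[OF assms])
  show "\<forall>\<^sub>F N in sequentially. ?P N \<le> 1"
    by simp
  define q where "q = 1 - p\<^sup>2"
  have q: "0 < q" "q < 1"
    using assms by (simp_all add: q_def power_less_one_iff)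
  \<comment> \<open>Shifting the index by 2 removes the truncated subtraction in
    \<open>N - 2\<close>; \<open>LIMSEQ_offset\<close> undoes the shift.\<close>
  have "(\<lambda>N. 1 - real (N + 2) * q ^ N) \<longlonglongrightarrow> 1"
    using q by real_asymp
  then have "(\<lambda>N. 1 - real (N + 2) * q ^ (N + 2 - 2)) \<longlonglongrightarrow> 1"
    by simp
  then show "(\<lambda>N. 1 - real N * (1 - p\<^sup>2) ^ (N - 2)) \<longlonglongrightarrow> 1"
    unfolding q_def by (rule LIMSEQ_offset)
qed simp

end
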